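(* Let $f:2^N\to\mathbb{R}$ be a monotone subadditive function with $f(\emptyset)=0$ on a finite ground set $N$ of size $n$, and let $\pi$ be a known weak submodular order for $f$. For the problem of maximizing $f(S)$ subject to the cardinality constraint $|S|\le k$, the algorithm Threshold-Cardinality described in the context is $(1-\epsilon)\,0.5$ approximate, i.e. it outputs a set $S\subseteq N$ with $|S|\le k$ and $$f(S)\;\ge\;(1-\epsilon)\,0.5\,\max_{T\subseteq N,\ |T|\le k} f(T),$$ with $O\!\left(\frac{n}{\epsilon}\log k\right)$ value oracle queries, for any choice of $\epsilon\in(0,1)$.
   Context: Notation: $f(X\mid S)=f(X\cup S)-f(S)$, and $f(e\mid S)=f(\{e\}\mid S)$. $f$ is monotone if $f(A)\ge f(B)$ whenever $B\subseteq A\subseteq N$, and subadditive if $f(A)+f(B)\ge f(A\cup B)$ for all $A,B\subseteq N$. A value oracle returns $f(S)$ for a queried set $S$. The integer $k$ is the cardinality parameter. A permutation $\pi$ of $N$ is used to index the elements from left to right; $l_\pi(S)$ and $r_\pi(S)$ denote the leftmost (smallest index) and rightmost (largest index) elements of $S$, and inequalities between them compare positions in $\pi$ (they hold vacuously when an involved set is empty). Sets $B\subseteq A$ are $\pi$-nested if $l_\pi(A\setminus B)>r_\pi(B)$. The permutation $\pi$ is a weak submodular order for $f$ if $f(C\mid A)\le f(C\mid B)$ for all $\pi$-nested sets $B\subseteq A$ and every set $C$ with $l_\pi(C)>r_\pi(A)$. Algorithm Threshold-Cardinality (input $k,\epsilon$, and $N=\{1,\dots,n\}$ indexed in the order $\pi$):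 set $\tau=\frac1k\max_{e\in N}f(\{e\})$. For each $i\in\{1,2,\dots,\lceil\log_{1+\epsilon}k\rceil\}$ let $\tau_i=(1+\epsilon)^{i-1}\tau$ and build $S_i$ as follows: start with $S_i=\emptyset$; parse $j=1,2,\dots,n$ in order while $|S_i|<k$, and add $j$ to $S_i$ whenever $f(j\mid S_i)\ge\tau_i$. Output a set of largest $f$-value among the sets $S_1,\dots,S_{\lceil\log_{1+\epsilon}k\rceil}$.
   Formalization: The formal theorem assumes k ≥ 2 and N nonempty: for k = 1 the algorithm builds no sets S_i (the number of thresholds is 0) and so has no output, for k = 0 the factor 1/k is undefined, and for empty N the maximum defining τ is undefined. *)

theory Defs
  imports Complex_Main "HOL-Combinatorics.Multiset_Permutations"
begin

section \<open>Set functions\<close>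

definition gain :: "('a set \<Rightarrow> real) \<Rightarrow> 'a set \<Rightarrow> 'a set \<Rightarrow> real" where
  "gain f X S = f (X \<union> S) - f S"

definition subadditive_on :: "'a set \<Rightarrow> ('a set \<Rightarrow> real) \<Rightarrow> bool" where
  "subadditive_on N f \<longleftrightarrow> (\<forall>A B. A \<subseteq> N \<and> B \<subseteq> N \<longrightarrow> f A + f B \<ge> f (A \<union> B))"


section \<open>Weak submodular orders\<close>

text \<open>A permutation of \<open>N\<close> is the list of its elements from left to right, that is, a member of
  \<^const>\<open>permutations_of_set\<close>.\<close>

definition position :: "'a list \<Rightarrow> 'a \<Rightarrow> nat" where
  "position \<pi> x = (THE i. i < length \<pi> \<and> \<pi> ! i = x)"

definition leftmost :: "'a list \<Rightarrow> 'a set \<Rightarrow> 'a" where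
  "leftmost \<pi> S = arg_min_on (position \<pi>) S"

definition rightmost :: "'a list \<Rightarrow> 'a set \<Rightarrow> 'a" where
  "rightmost \<pi> S = arg_max_on (position \<pi>) S"

text \<open>The inequality \<open>l\<^sub>\<pi>(T) > r\<^sub>\<pi>(S)\<close>, which holds vacuously if one of the sets is empty.\<close>

definition lies_before :: "'a list \<Rightarrow> 'a set \<Rightarrow> 'a set \<Rightarrow> bool" where
  "lies_before \<pi> S T \<longleftrightarrow>
     S = {} \<or> T = {} \<or> position \<pi> (leftmost \<pi> T) > position \<pi> (rightmost \<pi> S)"

definition nested :: "'a list \<Rightarrow> 'a set \<Rightarrow> 'a set \<Rightarrow> bool" where
  "nested \<pi> B A \<longleftrightarrow> B \<subseteq> A \<and> lies_before \<pi> B (A - B)"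

definition weak_submodular_order :: "'a set \<Rightarrow> ('a set \<Rightarrow> real) \<Rightarrow> 'a list \<Rightarrow> bool" where
  "weak_submodular_order N f \<pi> \<longleftrightarrow>
     (\<forall>A B C. A \<subseteq> N \<and> C \<subseteq> N \<and> nested \<pi> B A \<and> lies_before \<pi> A C \<longrightarrow>
        gain f C A \<le> gain f C B)"


section \<open>Programs with access to a value oracle\<close>

text \<open>A program can inspect the objective function only through \<open>Query\<close> nodes, so that counting
  the nodes visited in a run counts all oracle calls.\<close>

datatype ('q, 'r, 'x) oracle_prog =
    Return 'x
  | Query 'q "'r \<Rightarrow> ('q, 'r, 'x) oracle_prog"

primrec bind_prog ::
  "('q, 'r, 'x) oracle_prog \<Rightarrow> ('x \<Rightarrow> ('q, 'r, 'y) oracle_prog) \<Rightarrow> ('q, 'r, 'y) oracle_prog"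
  (infixl "\<triangleright>" 54)
where
  "Return x \<triangleright> g = g x"
| "Query q c \<triangleright> g = Query q (\<lambda>r. c r \<triangleright> g)"

primrec run :: "('q \<Rightarrow> 'r) \<Rightarrow> ('q, 'r, 'x) oracle_prog \<Rightarrow> 'x" where
  "run f (Return x) = x"
| "run f (Query q c) = run f (c (f q))"

primrec queries :: "('q \<Rightarrow> 'r) \<Rightarrow> ('q, 'r, 'x) oracle_prog \<Rightarrow> nat" where
  "queries f (Return x) = 0"
| "queries f (Query q c) = Suc (queries f (c (f q)))"

lemma run_bind_prog [simp]: "run f (p \<triangleright> g) = run f (g (run f p))"
  by (induction p) auto

lemma queries_bind_prog [simp]:
  "queries f (p \<triangleright> g) = queries f p + queries f (g (run f p))"
  by (induction p) auto

definition query :: "'q \<Rightarrow> ('q, 'r, 'r) oracle_prog" where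
  "query q = Query q Return"

primrec map_prog ::
  "('b \<Rightarrow> ('q, 'r, 'x) oracle_prog) \<Rightarrow> 'b list \<Rightarrow> ('q, 'r, 'x list) oracle_prog"
where
  "map_prog g [] = Return []"
| "map_prog g (b # bs) = g b \<triangleright> (\<lambda>x. map_prog g bs \<triangleright> (\<lambda>xs. Return (x # xs)))"


section \<open>The algorithm\<close>

definition query_gain :: "'a \<Rightarrow> 'a set \<Rightarrow> ('a set, real, real) oracle_prog" where
  "query_gain e S = query ({e} \<union> S) \<triangleright> (\<lambda>v. query S \<triangleright> (\<lambda>w. Return (v - w)))"

primrec threshold_greedy ::
  "nat \<Rightarrow> real \<Rightarrow> 'a list \<Rightarrow> 'a set \<Rightarrow> ('a set, real, 'a set) oracle_prog"
where
  "threshold_greedy k \<theta> [] S = Return S"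
| "threshold_greedy k \<theta> (j # js) S =
     (if card S < k
      then query_gain j S \<triangleright> (\<lambda>g. threshold_greedy k \<theta> js (if g \<ge> \<theta> then {j} \<union> S else S))
      else Return S)"

text \<open>The result of the program is the set of all admissible outputs: ties between candidates of
  largest value may be broken arbitrarily.\<close>

definition threshold_cardinality ::
  "nat \<Rightarrow> real \<Rightarrow> 'a list \<Rightarrow> ('a set, real, 'a set set) oracle_prog"
where
  "threshold_cardinality k \<epsilon> \<pi> =
     map_prog (\<lambda>e. query {e}) \<pi> \<triangleright> (\<lambda>vs.
       let \<tau> = 1 / real k * Max (set vs);
           m = nat \<lceil>log (1 + \<epsilon>) (real k)\<rceil>
       in map_prog (\<lambda>i. threshold_greedy k ((1 + \<epsilon>) ^ (i - 1) * \<tau>) \<pi> {}) [1..<Suc m] \<triangleright> (\<lambda>Ss.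
            map_prog query Ss \<triangleright> (\<lambda>ws.
              Return {S. \<exists>w. (S, w) \<in> set (zip Ss ws) \<and> w = Max (set ws)})))"

end

theory Submission
  imports Defs
begin

text \<open>
  Let \<open>M\<close> be the largest value of a singleton and \<open>OPT\<close> the optimum. One run with threshold
  \<open>\<theta>\<close> gives a set \<open>G\<close> of value at least \<open>\<theta> * card G\<close>, because every accepted element
  contributes at least \<open>\<theta>\<close> (\<open>threshold_greedy_value\<close>). If the run ends with room to
  spare, then every element of a competing set \<open>T\<close> has been offered and either accepted or found to
  gain less than \<open>\<theta>\<close> over the elements accepted before it. A weak submodular order is exactly what
  turns these local rejections into the global bound \<open>f T \<le> f G + \<theta> * card T\<close>
  (\<open>threshold_greedy_not_full\<close>): the rejected elements are dropped from \<open>T\<close> from left to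
  right, and each drop compares the sets \<open>P\<close> and \<open>insert j P\<close>, where the accepted prefix \<open>P\<close> lies
  wholly before the rejected \<open>j\<close>, so that they are nested in the order; the rest of \<open>T\<close> comes after
  both. So for \<open>\<theta>\<close> at most \<open>OPT / (2 * k)\<close>, and at least \<open>1 - \<epsilon>\<close> times that, both outcomes
  give a set of value at least \<open>(1 - \<epsilon>) * OPT / 2\<close>.

  It remains to see that some threshold \<open>(1 + \<epsilon>) ^ (i - 1) * M / k\<close> serves. By subadditivity
  \<open>OPT \<le> k * M\<close>, so \<open>x = OPT / (2 * M)\<close> is less than \<open>k \<le> (1 + \<epsilon>) ^ m\<close>, where \<open>m\<close> is the
  number of thresholds (for \<open>M = 0\<close> all values vanish). If \<open>x \<ge> 1\<close>, it lies between two
  consecutive powers of \<open>1 + \<epsilon>\<close>, and the lower one gives the threshold wanted. If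
  \<open>x < 1\<close>, even the smallest threshold exceeds \<open>OPT / (2 * k)\<close>, but now it is enough to obtain value \<open>(1 - \<epsilon>) * M\<close>. The largest threshold lies
  between \<open>M / (1 + \<epsilon>)\<close> and \<open>M\<close>, so the best singleton is accepted unless something else was
  accepted before. Either way the last run builds a nonempty set, which has value at least
  \<open>M / (1 + \<epsilon>) \<ge> (1 - \<epsilon>) * M\<close>.

  The number of oracle calls is at most \<open>n\<close> for the singletons, \<open>2 * n\<close> for each of the \<open>m\<close> runs
  and \<open>m\<close> for the final comparison, and \<open>m\<close> is of the order of \<open>ln k / \<epsilon>\<close> because
  \<open>ln (1 + \<epsilon>)\<close> is at least \<open>\<epsilon> / 2\<close> on the unit interval.
\<close>

section \<open>Sets separated by a cut of the order\<close>

lemma position_nth: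
  assumes "distinct \<pi>" "i < length \<pi>"
  shows "position \<pi> (\<pi> ! i) = i"
  unfolding position_def using assms by (intro the_equality) (auto simp: nth_eq_iff_index_eq)

lemma position_less_of_append:
  assumes "distinct (xs @ ys)" "x \<in> set xs" "y \<in> set ys"
  shows "position (xs @ ys) x < position (xs @ ys) y"
proof -
  obtain i where i: "i < length xs" "x = xs ! i"
    using assms(2) by (auto simp: in_set_conv_nth)
  obtain l where l: "l < length ys" "y = ys ! l"
    using assms(3) by (auto simp: in_set_conv_nth)
  have "position (xs @ ys) x = i"
    using position_nth[OF assms(1), of i] i by (simp add: nth_append)
  moreover have "position (xs @ ys) y = length xs + l"
    using position_nth[OF assms(1), of "length xs + l"] l by (simp add: nth_append)
  ultimately show ?thesis using i by simp
qed

lemma leftmost_in: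
  assumes "finite S" "S \<noteq> {}"
  shows "leftmost \<pi> S \<in> S"
  unfolding leftmost_def using arg_min_if_finite(1)[OF assms] .

lemma rightmost_in:
  assumes "finite S" "S \<noteq> {}"
  shows "rightmost \<pi> S \<in> S"
proof -
  obtain x where "x \<in> S" using assms by auto
  moreover have "\<forall>y. y \<in> S \<longrightarrow> position \<pi> y < Suc (Max (position \<pi> ` S))"
    using assms by (auto simp: less_Suc_eq_le)
  ultimately show ?thesis
    unfolding rightmost_def arg_max_on_def by (rule arg_max_natI)
qed

lemma lies_before_append:
  assumes "distinct (xs @ ys)" "S \<subseteq> set xs" "T \<subseteq> set ys"
  shows "lies_before (xs @ ys) S T"
proof (cases "S = {} \<or> T = {}")
  case False
  have "finite S" "finite T" using assms finite_subset by blast+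
  then have "rightmost (xs @ ys) S \<in> set xs" "leftmost (xs @ ys) T \<in> set ys"
    using False rightmost_in[of S] leftmost_in[of T] assms by blast+
  then show ?thesis
    unfolding lies_before_def using position_less_of_append[OF assms(1)] by blast
qed (auto simp: lies_before_def)

text \<open>A rejected element \<open>j\<close> cannot become valuable later: the gain of \<open>C\<close> over \<open>insert j S\<close> is at
  most its gain over \<open>S\<close>, and rearranging the four values involved bounds what \<open>j\<close> adds to
  \<open>S \<union> C\<close> by what it adds to \<open>S\<close>.\<close>

lemma weak_submodular_order_drop:
  fixes f :: "'a set \<Rightarrow> real"
  assumes order: "weak_submodular_order N f (xs @ j # ys)"
    and dist: "distinct (xs @ j # ys)" and N: "set (xs @ j # ys) = N"
    and S: "S \<subseteq> set xs" and C: "C \<subseteq> set ys"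
  shows "f (insert j (S \<union> C)) \<le> f (S \<union> C) + gain f {j} S"
proof -
  have "lies_before (xs @ j # ys) S (insert j S - S)"
    by (rule lies_before_append) (use dist S in auto)
  then have "nested (xs @ j # ys) S (insert j S)"
    by (auto simp: nested_def)
  moreover have "lies_before ((xs @ [j]) @ ys) (insert j S) C"
    by (rule lies_before_append) (use dist S C in auto)
  ultimately have "gain f C (insert j S) \<le> gain f C S"
    using order[unfolded weak_submodular_order_def, rule_format, of "insert j S" C S] S C
    unfolding N[symmetric] by auto
  then show ?thesis
    by (simp add: gain_def Un_commute)
qed

section \<open>A single run with a fixed threshold\<close>

lemma run_query_gain [simp]: "run f (query_gain e S) = gain f {e} S"
  by (simp add: query_gain_def query_def gain_def)

lemma run_threshold_greedy_Cons:
  "run f (threshold_greedy k \<theta> (j # js) S) =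
     (if card S < k
      then run f (threshold_greedy k \<theta> js (if gain f {j} S \<ge> \<theta> then insert j S else S))
      else S)"
  by simp

lemma queries_threshold_greedy:
  "queries f (threshold_greedy k \<theta> js S) \<le> 2 * length js"
  by (induction js arbitrary: S)
    (auto simp: query_gain_def query_def intro: le_SucI)

lemma threshold_greedy_superset:
  "S \<subseteq> run f (threshold_greedy k \<theta> js S)"
proof (induction js arbitrary: S)
  case (Cons j js)
  show ?case
    using Cons[of "insert j S"] Cons[of S] by (auto simp: run_threshold_greedy_Cons)
qed simp

lemma threshold_greedy_subset:
  "run f (threshold_greedy k \<theta> js S) \<subseteq> S \<union> set js"
proof (induction js arbitrary: S)
  case (Cons j js)
  show ?case
    using Cons[of "insert j S"] Cons[of S] by (auto simp: run_threshold_greedy_Cons)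
qed simp

lemma threshold_greedy_card:
  "card S \<le> k \<Longrightarrow> card (run f (threshold_greedy k \<theta> js S)) \<le> k"
proof (induction js arbitrary: S)
  case (Cons j js)
  have "card S < k \<Longrightarrow> card (insert j S) \<le> k"
    using card_insert_le_m1[of k S j] by simp
  then show ?case
    using Cons by (auto simp: run_threshold_greedy_Cons)
qed simp

lemma threshold_greedy_value:
  fixes f :: "'a set \<Rightarrow> real"
  assumes "distinct js" "finite S" "S \<inter> set js = {}"
  shows "f (run f (threshold_greedy k \<theta> js S))
    \<ge> f S + \<theta> * (real (card (run f (threshold_greedy k \<theta> js S))) - real (card S))"
  using assms
proof (induction js arbitrary: S)
  case (Cons j js)
  show ?case
  proof (cases "card S < k \<and> gain f {j} S \<ge> \<theta>")
    case True
    have "f (insert j S) \<ge> f S + \<theta>"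
      using True by (simp add: gain_def)
    moreover have "card (insert j S) = Suc (card S)"
      using Cons.prems by auto
    moreover have "distinct js" "finite (insert j S)" "insert j S \<inter> set js = {}"
      using Cons.prems by auto
    note Cons.IH[OF this]
    ultimately show ?thesis
      using True by (simp add: run_threshold_greedy_Cons algebra_simps)
  next
    case False
    then show ?thesis
      using Cons by (auto simp: run_threshold_greedy_Cons)
  qed
qed simp

lemma threshold_greedy_nonempty:
  fixes f :: "'a set \<Rightarrow> real"
  assumes "e \<in> set js" "\<theta> \<le> f {e}" "f {} = 0" "0 < k"
  shows "run f (threshold_greedy k \<theta> js {}) \<noteq> {}"
  using assms(1)
proof (induction js)
  case (Cons j js)
  show ?case
  proof (cases "\<theta> \<le> f {j}")
    case True
    then show ?thesis
      using assms threshold_greedy_superset[of "{j}" f k \<theta> js]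
      by (auto simp: run_threshold_greedy_Cons gain_def)
  next
    case False
    then have "e \<in> set js" using Cons.prems assms by auto
    then show ?thesis
      using False Cons.IH assms by (simp add: run_threshold_greedy_Cons gain_def)
  qed
qed simp

text \<open>An accepted set with room to spare loses at most \<open>\<theta>\<close> per competing element. The induction
  follows the run, so that \<open>A\<close> is the part of the competitor still to come: an accepted element moves
  from \<open>A\<close> to \<open>S\<close> for free, and a rejected one is paid for when it is dropped.\<close>

lemma threshold_greedy_not_full:
  fixes f :: "'a set \<Rightarrow> real"
  assumes "weak_submodular_order N f (xs @ js)"
    and "distinct (xs @ js)" and "set (xs @ js) = N"
    and "mono_on (Pow N) f" and "0 \<le> \<theta>"
    and "S \<subseteq> set xs" and "A \<subseteq> set js"
    and "card (run f (threshold_greedy k \<theta> js S)) < k"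
  shows "f (S \<union> A) \<le> f (run f (threshold_greedy k \<theta> js S)) + \<theta> * real (card A)"
  using assms
proof (induction js arbitrary: xs S A)
  case (Cons j js)
  let ?S' = "if gain f {j} S \<ge> \<theta> then insert j S else S"
  let ?G = "run f (threshold_greedy k \<theta> js ?S')"
  have "card S < k"
    using Cons.prems(8) by (auto simp: run_threshold_greedy_Cons split: if_splits)
  then have G: "run f (threshold_greedy k \<theta> (j # js) S) = ?G"
    by (simp add: run_threshold_greedy_Cons)
  have finA: "finite A" using Cons.prems(7) finite_subset by blast
  have sub: "S \<union> A \<subseteq> N" "insert j (S \<union> A) \<subseteq> N" "?S' \<subseteq> set (xs @ [j])" "A - {j} \<subseteq> set js"
    using Cons.prems(3,6,7) by auto
  have IH: "f (?S' \<union> (A - {j})) \<le> f ?G + \<theta> * real (card (A - {j}))"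
  proof (rule Cons.IH[OF _ _ _ Cons.prems(4,5) sub(3,4)])
    show "weak_submodular_order N f ((xs @ [j]) @ js)" "distinct ((xs @ [j]) @ js)"
      "set ((xs @ [j]) @ js) = N"
      using Cons.prems(1-3) by simp_all
    show "card ?G < k" using Cons.prems(8) unfolding G .
  qed
  show ?case
  proof (cases "gain f {j} S \<ge> \<theta> \<or> j \<notin> A")
    case True
    have "f (S \<union> A) \<le> f (?S' \<union> (A - {j}))"
      by (rule mono_onD[OF Cons.prems(4)]) (use True sub in \<open>auto split: if_splits\<close>)
    moreover have "\<theta> * real (card (A - {j})) \<le> \<theta> * real (card A)"
      using \<open>0 \<le> \<theta>\<close> finA by (intro mult_left_mono) (auto intro: card_mono)
    ultimately show ?thesis unfolding G using IH by linarith
  next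
    case False
    have "f (insert j (S \<union> (A - {j}))) \<le> f (S \<union> (A - {j})) + gain f {j} S"
      using Cons.prems(1-3,6) sub(4) by (rule weak_submodular_order_drop)
    moreover have "insert j (S \<union> (A - {j})) = S \<union> A" using False by auto
    ultimately have "f (S \<union> A) \<le> f (S \<union> (A - {j})) + gain f {j} S" by simp
    moreover have "f (S \<union> (A - {j})) \<le> f ?G + \<theta> * real (card (A - {j}))"
      using IH False by simp
    moreover have "\<theta> * real (card A) = \<theta> * real (card (A - {j})) + \<theta>"
      by (subst card.remove[OF finA, of j]) (use False in \<open>auto simp: algebra_simps\<close>)
    ultimately show ?thesis
      unfolding G using False by linarith
  qed
qed simp

text \<open>A full set is good because the threshold is not too small, any other because it is not too
  large.\<close>

lemma threshold_greedy_near_optimal: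
  fixes f :: "'a set \<Rightarrow> real"
  assumes order: "weak_submodular_order N f \<pi>" and perm: "\<pi> \<in> permutations_of_set N"
    and mono: "mono_on (Pow N) f" and "f {} = 0"
    and T: "T \<subseteq> N" "card T \<le> k"
    and "0 \<le> \<theta>" and upper: "k * \<theta> \<le> f T / 2" and lower: "v \<le> k * \<theta>" "v \<le> f T / 2"
  shows "v \<le> f (run f (threshold_greedy k \<theta> \<pi> {}))"
proof -
  let ?G = "run f (threshold_greedy k \<theta> \<pi> {})"
  have \<pi>: "distinct \<pi>" "set \<pi> = N" using perm by (auto dest: permutations_of_setD)
  have "card ?G \<le> k" by (rule threshold_greedy_card) simp
  then consider "card ?G = k" | "card ?G < k" by linarith
  then show ?thesis
  proof cases
    case 1
    then show ?thesis
      using threshold_greedy_value[of \<pi> "{}" f \<theta> k] \<pi> \<open>f {} = 0\<close> lower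
      by (simp add: mult.commute)
  next
    case 2
    have "f T \<le> f ?G + \<theta> * real (card T)"
      using threshold_greedy_not_full[of N f "[]" \<pi> \<theta> "{}" T k] order \<pi> mono T \<open>0 \<le> \<theta>\<close> 2
      by simp
    moreover have "\<theta> * real (card T) \<le> k * \<theta>"
      using T \<open>0 \<le> \<theta>\<close> by (simp add: mult.commute mult_left_mono)
    ultimately show ?thesis using upper lower by simp
  qed
qed

section \<open>The grid of thresholds\<close>

lemma number_of_thresholds_ge_1:
  fixes \<epsilon> :: real
  assumes "0 < \<epsilon>" "2 \<le> k"
  shows "1 \<le> nat \<lceil>log (1 + \<epsilon>) (real k)\<rceil>"
proof -
  have "0 < log (1 + \<epsilon>) (real k)" using assms by simp
  then show ?thesis by linarith
qed

lemma le_power_nat_ceiling_log: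
  fixes b x :: real
  assumes "1 < b" "0 < x"
  shows "x \<le> b ^ nat \<lceil>log b x\<rceil>"
proof -
  have "x = b powr (log b x)" using assms by simp
  also have "\<dots> \<le> b powr real (nat \<lceil>log b x\<rceil>)"
    using assms by (intro powr_mono real_nat_ceiling_ge) auto
  also have "\<dots> = b ^ nat \<lceil>log b x\<rceil>" using assms by (simp add: powr_realpow)
  finally show ?thesis .
qed

lemma power_nat_ceiling_log_less:
  fixes b x :: real
  assumes "1 < b" "1 < x"
  shows "b ^ (nat \<lceil>log b x\<rceil> - 1) < x"
proof -
  have "0 < log b x" using assms by simp
  then have "real (nat \<lceil>log b x\<rceil> - 1) < log b x" by linarith
  then have "b powr real (nat \<lceil>log b x\<rceil> - 1) < b powr log b x"
    using assms by (intro powr_less_mono) auto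
  then show ?thesis using assms by (simp add: powr_realpow)
qed

lemma between_consecutive_powers:
  fixes b x :: real
  assumes "1 \<le> x" "x < b ^ m"
  obtains i where "1 \<le> i" "i \<le> m" "b ^ (i - 1) \<le> x" "x < b ^ i"
proof -
  define i where "i = (LEAST i. x < b ^ i)"
  have i: "x < b ^ i" "i \<le> m"
    unfolding i_def using assms(2) by (auto intro: LeastI Least_le)
  then have "1 \<le> i" using assms(1) by (cases i) auto
  moreover have "b ^ (i - 1) \<le> x"
    using not_less_Least[of "i - 1" "\<lambda>i. x < b ^ i"] \<open>1 \<le> i\<close> by (fold i_def) auto
  ultimately show thesis using i that by blast
qed

lemma ln_one_plus_ge_half:
  fixes \<epsilon> :: real
  assumes "0 < \<epsilon>" "\<epsilon> < 1"
  shows "\<epsilon> / 2 \<le> ln (1 + \<epsilon>)"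
proof -
  have "\<epsilon> / 2 \<le> \<epsilon> / (1 + \<epsilon>)" using assms by (intro divide_left_mono) auto
  also have "\<dots> = 1 - 1 / (1 + \<epsilon>)" using assms by (simp add: field_simps)
  also have "\<dots> \<le> ln (1 + \<epsilon>)"
    using ln_le_minus_one[of "1 / (1 + \<epsilon>)"] assms by (simp add: ln_div)
  finally show ?thesis .
qed

lemma one_le_2_ln:
  assumes "2 \<le> k"
  shows "1 \<le> 2 * ln (real k)"
proof -
  have "1 / 2 \<le> ln (2::real)" using ln_le_minus_one[of "1 / 2 :: real"] by (simp add: ln_div)
  also have "\<dots> \<le> ln (real k)" using assms by simp
  finally show ?thesis by simp
qed

lemma number_of_thresholds_le:
  fixes \<epsilon> :: real
  assumes "0 < \<epsilon>" "\<epsilon> < 1" "2 \<le> k"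
  shows "real (nat \<lceil>log (1 + \<epsilon>) (real k)\<rceil>) \<le> 4 * (ln (real k) / \<epsilon>)"
proof -
  have "0 < ln (real k)" using assms by simp
  have "log (1 + \<epsilon>) (real k) \<le> ln (real k) / (\<epsilon> / 2)"
    unfolding log_def
    using assms \<open>0 < ln (real k)\<close> ln_one_plus_ge_half[of \<epsilon>] by (intro divide_left_mono) auto
  moreover have "1 \<le> 2 * (ln (real k) / \<epsilon>)"
    using one_le_2_ln[OF assms(3)] assms by (simp add: field_simps)
  moreover have "0 < log (1 + \<epsilon>) (real k)" using assms by simp
  then have "real (nat \<lceil>log (1 + \<epsilon>) (real k)\<rceil>) \<le> log (1 + \<epsilon>) (real k) + 1" by linarith
  ultimately show ?thesis by simp
qed

text \<open>Here \<open>e\<close> is to be a best singleton. The values \<open>k * \<theta>\<close> range over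
  \<open>(1 + \<epsilon>) ^ (i - 1) * f {e}\<close>. One of them is below half of \<open>f T\<close> by a factor of at most
  \<open>1 + \<epsilon>\<close>, unless \<open>f T / 2\<close> is below \<open>f {e}\<close>; then the last run, whose threshold is about
  \<open>f {e}\<close> itself, is good enough with a single element.\<close>

lemma some_threshold_near_optimal:
  fixes f :: "'a set \<Rightarrow> real" and \<epsilon> :: real and k :: nat
  defines "m \<equiv> nat \<lceil>log (1 + \<epsilon>) (real k)\<rceil>"
  assumes order: "weak_submodular_order N f \<pi>" and perm: "\<pi> \<in> permutations_of_set N"
    and mono: "mono_on (Pow N) f" and empty: "f {} = 0"
    and eps: "0 < \<epsilon>" "\<epsilon> < 1" and k: "2 \<le> k"
    and T: "T \<subseteq> N" "card T \<le> k"
    and e: "e \<in> N" and M: "f T \<le> k * f {e}"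
  obtains i where "1 \<le> i" "i \<le> m"
    "(1 - \<epsilon>) * (f T / 2)
       \<le> f (run f (threshold_greedy k ((1 + \<epsilon>) ^ (i - 1) * (1 / k * f {e})) \<pi> {}))"
proof -
  define \<theta> where "\<theta> i = (1 + \<epsilon>) ^ (i - 1) * (1 / k * f {e})" for i
  define G where "G i = run f (threshold_greedy k (\<theta> i) \<pi> {})" for i
  have \<pi>: "distinct \<pi>" "set \<pi> = N" using perm by (auto dest: permutations_of_setD)
  have M0: "0 \<le> f {e}" using mono_onD[OF mono, of "{}" "{e}"] e empty by auto
  have fT0: "0 \<le> f T" using mono_onD[OF mono, of "{}" T] T empty by auto
  have \<theta>0: "0 \<le> \<theta> i" for i using M0 eps by (simp add: \<theta>_def)
  have k\<theta>: "k * \<theta> i = (1 + \<epsilon>) ^ (i - 1) * f {e}" for i using k by (simp add: \<theta>_def)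
  have m1: "1 \<le> m" unfolding m_def using number_of_thresholds_ge_1[OF eps(1) k] .
  have km: "real k \<le> (1 + \<epsilon>) ^ m"
    unfolding m_def by (rule le_power_nat_ceiling_log) (use eps k in auto)
  \<comment> \<open>Missing a target by a factor \<open>1 + \<epsilon>\<close> loses at most a fraction \<open>\<epsilon>\<close> of it, because
    \<open>(1 - \<epsilon>) * (1 + \<epsilon>) \<le> 1\<close>.\<close>
  have shrink: "(1 - \<epsilon>) * y \<le> z" if "y \<le> (1 + \<epsilon>) * z" "0 \<le> z" for y z
  proof -
    have "(1 - \<epsilon>) * y \<le> (1 - \<epsilon>) * ((1 + \<epsilon>) * z)"
      using that eps by (intro mult_left_mono) auto
    also have "\<dots> = z - \<epsilon> * \<epsilon> * z" by (simp add: algebra_simps)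
    also have "\<dots> \<le> z" using that by simp
    finally show ?thesis .
  qed
  have "\<exists>i. 1 \<le> i \<and> i \<le> m \<and> (1 - \<epsilon>) * (f T / 2) \<le> f (G i)"
  proof (cases "f T / 2 < f {e}")
    case True
    have "\<theta> m = ((1 + \<epsilon>) ^ (m - 1) / k) * f {e}" by (simp add: \<theta>_def)
    also have "\<dots> \<le> 1 * f {e}"
      using power_nat_ceiling_log_less[of "1 + \<epsilon>" "real k"] eps k M0
      by (intro mult_right_mono) (auto simp: m_def)
    finally have "G m \<noteq> {}"
      unfolding G_def using e \<pi> empty k by (intro threshold_greedy_nonempty[of e]) auto
    moreover have "finite (G m)"
      unfolding G_def
      using threshold_greedy_subset[of f k "\<theta> m" \<pi> "{}"] by (auto intro: finite_subset)
    ultimately have "1 \<le> card (G m)" by (simp add: Suc_leI card_gt_0_iff)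
    then have "\<theta> m \<le> \<theta> m * real (card (G m))"
      using \<theta>0[of m] by (simp add: mult_le_cancel_left1)
    also have "\<dots> \<le> f (G m)"
      using threshold_greedy_value[of \<pi> "{}" f "\<theta> m" k] \<pi> empty by (simp add: G_def)
    finally have Gm: "\<theta> m \<le> f (G m)" .
    have "f {e} = real k * f {e} / k" using k by simp
    also have "\<dots> \<le> (1 + \<epsilon>) ^ m * f {e} / k"
      using km M0 by (intro divide_right_mono mult_right_mono) auto
    also have "\<dots> = (1 + \<epsilon>) * \<theta> m"
      using m1 by (cases m) (auto simp: \<theta>_def)
    finally have "(1 - \<epsilon>) * (f T / 2) \<le> \<theta> m"
      using True \<theta>0 by (intro shrink) auto
    then show ?thesis using m1 Gm by (intro exI[of _ m]) auto
  next
    case False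
    show ?thesis
    proof (cases "f {e} = 0")
      case True
      then have "f T = 0" using M fT0 by simp
      then have "(1 - \<epsilon>) * (f T / 2) \<le> f (G 1)"
        unfolding G_def
        by (intro threshold_greedy_near_optimal[OF order perm mono empty T]) (auto simp: \<theta>_def True)
      then show ?thesis using m1 by blast
    next
      case nz: False
      define x where "x = f T / 2 / f {e}"
      have Mpos: "0 < f {e}" using nz M0 by simp
      have x: "f T / 2 = x * f {e}" using Mpos by (simp add: x_def)
      have "1 \<le> x" using False Mpos by (simp add: x_def)
      moreover have "x < (1 + \<epsilon>) ^ m"
      proof -
        have "2 * x * f {e} \<le> k * f {e}" using M x by simp
        then have "2 * x \<le> k" using Mpos by simp
        then show ?thesis using km k by linarith
      qed
      ultimately obtain i where i: "1 \<le> i" "i \<le> m" "(1 + \<epsilon>) ^ (i - 1) \<le> x" "x < (1 + \<epsilon>) ^ i"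
        using between_consecutive_powers by metis
      have upper: "k * \<theta> i \<le> f T / 2"
        unfolding k\<theta> x using i Mpos by (intro mult_right_mono) auto
      have "f T / 2 \<le> (1 + \<epsilon>) ^ i * f {e}"
        unfolding x using i Mpos by (intro mult_right_mono) auto
      also have "\<dots> = (1 + \<epsilon>) * (k * \<theta> i)"
        unfolding k\<theta> using i by (cases i) auto
      finally have "(1 - \<epsilon>) * (f T / 2) \<le> k * \<theta> i"
        using \<theta>0[of i] by (intro shrink) auto
      moreover have "(1 - \<epsilon>) * (f T / 2) \<le> f T / 2"
        using fT0 eps by (simp add: algebra_simps)
      ultimately have "(1 - \<epsilon>) * (f T / 2) \<le> f (G i)"
        unfolding G_def
        by (intro threshold_greedy_near_optimal[OF order perm mono empty T \<theta>0 upper])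
      then show ?thesis using i by blast
    qed
  qed
  then show thesis using that unfolding G_def \<theta>_def by blast
qed

lemma subadditive_on_le_sum:
  fixes f :: "'a set \<Rightarrow> real"
  assumes sub: "subadditive_on N f" and empty: "f {} = 0" and "finite T" "T \<subseteq> N"
  shows "f T \<le> (\<Sum>e\<in>T. f {e})"
  using assms(3,4)
proof (induction T rule: finite_induct)
  case (insert e T)
  then have "f (insert e T) \<le> f {e} + f T"
    using sub[unfolded subadditive_on_def, rule_format, of "{e}" T] by simp
  moreover have "f T \<le> (\<Sum>e\<in>T. f {e})" using insert by blast
  ultimately show ?case using insert.hyps by simp
qed (simp add: empty)

section \<open>The whole algorithm\<close>

lemma run_map_prog: "run f (map_prog g xs) = map (\<lambda>x. run f (g x)) xs"
  by (induction xs) auto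

lemma queries_map_prog: "queries f (map_prog g xs) = (\<Sum>x\<leftarrow>xs. queries f (g x))"
  by (induction xs) auto

definition candidate_sets :: "('a set \<Rightarrow> real) \<Rightarrow> nat \<Rightarrow> real \<Rightarrow> 'a list \<Rightarrow> 'a set list" where
  "candidate_sets f k \<epsilon> \<pi> =
     map (\<lambda>i. run f (threshold_greedy k
                ((1 + \<epsilon>) ^ (i - 1) * (1 / real k * Max ((\<lambda>e. f {e}) ` set \<pi>))) \<pi> {}))
       [1..<Suc (nat \<lceil>log (1 + \<epsilon>) (real k)\<rceil>)]"

lemma maximizers_zip_map:
  "{x. \<exists>w. (x, w) \<in> set (zip xs (map f xs)) \<and> w = Max (set (map f xs))} =
     {x \<in> set xs. f x = Max (f ` set xs)}"
  by (auto simp: zip_map2 zip_same_conv_map)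

lemma run_threshold_cardinality:
  "run f (threshold_cardinality k \<epsilon> \<pi>) =
     {S \<in> set (candidate_sets f k \<epsilon> \<pi>). f S = Max (f ` set (candidate_sets f k \<epsilon> \<pi>))}"
  unfolding maximizers_zip_map[symmetric] threshold_cardinality_def candidate_sets_def Let_def
  by (simp only: run_bind_prog run_map_prog query_def run.simps list.set_map)

lemma queries_threshold_cardinality_le:
  fixes k :: nat and \<epsilon> :: real
  defines "m \<equiv> nat \<lceil>log (1 + \<epsilon>) (real k)\<rceil>"
  shows "queries f (threshold_cardinality k \<epsilon> \<pi>)
    \<le> length \<pi> + 2 * m * length \<pi> + m"
proof -
  let ?\<theta> = "\<lambda>i. (1 + \<epsilon>) ^ (i - 1) * (1 / real k * Max ((\<lambda>e. f {e}) ` set \<pi>))"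
  have "queries f (threshold_cardinality k \<epsilon> \<pi>) =
      length \<pi> + (\<Sum>i\<leftarrow>[1..<Suc m]. queries f (threshold_greedy k (?\<theta> i) \<pi> {})) + m"
    unfolding threshold_cardinality_def Let_def m_def
    by (simp add: run_map_prog queries_map_prog query_def sum_list_triv comp_def del: upt_Suc)
  moreover have "(\<Sum>i\<leftarrow>[1..<Suc m]. queries f (threshold_greedy k (?\<theta> i) \<pi> {}))
      \<le> (\<Sum>i\<leftarrow>[1..<Suc m]. 2 * length \<pi>)"
    by (intro sum_list_mono queries_threshold_greedy)
  ultimately show ?thesis by (simp add: sum_list_triv del: upt_Suc)
qed

text \<open>As \<open>n\<close> and the number \<open>m\<close> of thresholds are at least \<open>1\<close>, all \<open>n + 2 * m * n + m\<close> queries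
  are absorbed in \<open>4 * n * m\<close>, and \<open>m \<le> 4 * ln k / \<epsilon>\<close>.\<close>

lemma queries_threshold_cardinality_bound:
  fixes \<epsilon> :: real
  assumes eps: "0 < \<epsilon>" "\<epsilon> < 1" and k: "2 \<le> k" and "\<pi> \<noteq> []"
  shows "real (queries f (threshold_cardinality k \<epsilon> \<pi>))
    \<le> 16 * (real (length \<pi>) / \<epsilon> * ln (real k))"
proof -
  define m where "m = nat \<lceil>log (1 + \<epsilon>) (real k)\<rceil>"
  have m1: "1 \<le> m" unfolding m_def using number_of_thresholds_ge_1[OF eps(1) k] .
  have "1 \<le> length \<pi>" using \<open>\<pi> \<noteq> []\<close> by (cases \<pi>) auto
  have "queries f (threshold_cardinality k \<epsilon> \<pi>)
      \<le> length \<pi> * 1 + 2 * m * length \<pi> + 1 * m"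
    using queries_threshold_cardinality_le[of f k \<epsilon> \<pi>] by (simp add: m_def)
  also have "\<dots> \<le> length \<pi> * m + 2 * m * length \<pi> + length \<pi> * m"
    using m1 \<open>1 \<le> length \<pi>\<close> by (intro add_mono mult_le_mono) auto
  also have "\<dots> = 4 * length \<pi> * m" by simp
  finally have "real (queries f (threshold_cardinality k \<epsilon> \<pi>)) \<le> real (4 * length \<pi> * m)"
    by (rule of_nat_mono)
  also have "\<dots> = 4 * real (length \<pi>) * real m" by simp
  also have "\<dots> \<le> 4 * real (length \<pi>) * (4 * (ln (real k) / \<epsilon>))"
    using number_of_thresholds_le[OF eps k] by (intro mult_left_mono) (auto simp: m_def)
  finally show ?thesis by simp
qed

lemma threshold_cardinality_approximation:
  fixes f :: "'a set \<Rightarrow> real" and \<epsilon> :: real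
  assumes order: "weak_submodular_order N f \<pi>" and perm: "\<pi> \<in> permutations_of_set N"
    and mono: "mono_on (Pow N) f" and sub: "subadditive_on N f" and empty: "f {} = 0"
    and eps: "0 < \<epsilon>" "\<epsilon> < 1" and k: "2 \<le> k" and N: "finite N" "N \<noteq> {}"
    and S: "S \<in> run f (threshold_cardinality k \<epsilon> \<pi>)" and T: "T \<subseteq> N" "card T \<le> k"
  shows "(1 - \<epsilon>) * (f T / 2) \<le> f S"
proof -
  define M where "M = Max ((\<lambda>e. f {e}) ` set \<pi>)"
  have \<pi>: "set \<pi> = N" using perm by (auto dest: permutations_of_setD)
  have "M \<in> (\<lambda>e. f {e}) ` N"
    unfolding M_def \<pi> using N by (intro Max_in) auto
  then obtain e where e: "e \<in> N" "M = f {e}" by auto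
  have "f T \<le> (\<Sum>e'\<in>T. f {e'})"
    using subadditive_on_le_sum[OF sub empty] T N finite_subset by blast
  also have "\<dots> \<le> real (card T) * f {e}"
    using T N by (intro sum_bounded_above) (auto simp: e(2)[symmetric] M_def \<pi> intro!: Max_ge)
  also have "\<dots> \<le> k * f {e}"
    using mono_onD[OF mono, of "{}" "{e}"] e empty T by (intro mult_right_mono) auto
  finally have fT: "f T \<le> k * f {e}" .
  obtain i where i: "1 \<le> i" "i \<le> nat \<lceil>log (1 + \<epsilon>) (real k)\<rceil>"
    "(1 - \<epsilon>) * (f T / 2)
       \<le> f (run f (threshold_greedy k ((1 + \<epsilon>) ^ (i - 1) * (1 / k * f {e})) \<pi> {}))"
    using some_threshold_near_optimal[OF order perm mono empty eps k T e(1) fT] .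
  have "run f (threshold_greedy k ((1 + \<epsilon>) ^ (i - 1) * (1 / k * f {e})) \<pi> {})
      \<in> set (candidate_sets f k \<epsilon> \<pi>)"
    unfolding candidate_sets_def e(2)[symmetric] M_def set_map
    by (rule image_eqI[of _ _ i]) (use i(1,2) in \<open>simp_all del: upt_Suc\<close>)
  then have "f (run f (threshold_greedy k ((1 + \<epsilon>) ^ (i - 1) * (1 / k * f {e})) \<pi> {}))
      \<le> Max (f ` set (candidate_sets f k \<epsilon> \<pi>))"
    by (intro Max_ge finite_imageI finite_set imageI)
  also have "\<dots> = f S"
    using S unfolding run_threshold_cardinality by (elim CollectE conjE) (rule sym)
  finally have "f (run f (threshold_greedy k ((1 + \<epsilon>) ^ (i - 1) * (1 / k * f {e})) \<pi> {})) \<le> f S" .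
  with i(3) show ?thesis by linarith
qed

theorem theorem2:
  "\<exists>c::real. \<forall>(N::'a set) (f::'a set \<Rightarrow> real) (\<pi>::'a list) (k::nat) (\<epsilon>::real).
     finite N \<and> N \<noteq> {} \<and>
     mono_on (Pow N) f \<and> subadditive_on N f \<and> f {} = 0 \<and>
     \<pi> \<in> permutations_of_set N \<and> weak_submodular_order N f \<pi> \<and>
     k \<ge> 2 \<and> 0 < \<epsilon> \<and> \<epsilon> < 1 \<longrightarrow>
       run f (threshold_cardinality k \<epsilon> \<pi>) \<noteq> {} \<and>
       (\<forall>S \<in> run f (threshold_cardinality k \<epsilon> \<pi>).
          S \<subseteq> N \<and> card S \<le> k \<and>
          f S \<ge> (1 - \<epsilon>) * 0.5 * Max {f T |T. T \<subseteq> N \<and> card T \<le> k}) \<and>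
       real (queries f (threshold_cardinality k \<epsilon> \<pi>))
         \<le> c * (real (card N) / \<epsilon> * ln (real k))"
proof (intro exI[of _ 16] allI impI, elim conjE, intro conjI ballI)
  fix N :: "'a set" and f :: "'a set \<Rightarrow> real" and \<pi> :: "'a list" and k :: nat and \<epsilon> :: real
  assume N: "finite N" "N \<noteq> {}" and mono: "mono_on (Pow N) f" and sub: "subadditive_on N f"
    and empty: "f {} = 0" and perm: "\<pi> \<in> permutations_of_set N"
    and order: "weak_submodular_order N f \<pi>" and k: "2 \<le> k" and eps: "0 < \<epsilon>" "\<epsilon> < 1"
  have \<pi>: "distinct \<pi>" "set \<pi> = N" using perm by (auto dest: permutations_of_setD)
  let ?C = "candidate_sets f k \<epsilon> \<pi>"
  have "?C \<noteq> []"
    using number_of_thresholds_ge_1[OF eps(1) k]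
    by (simp add: candidate_sets_def Suc_le_eq not_le del: upt_Suc)
  then have "Max (f ` set ?C) \<in> f ` set ?C"
    by (intro Max_in) auto
  then obtain B where "Max (f ` set ?C) = f B" "B \<in> set ?C"
    by (rule imageE)
  then have "B \<in> run f (threshold_cardinality k \<epsilon> \<pi>)"
    unfolding run_threshold_cardinality by (intro CollectI conjI) simp_all
  then show "run f (threshold_cardinality k \<epsilon> \<pi>) \<noteq> {}"
    by (rule ex_in_conv[THEN iffD1, OF exI])
  have "\<pi> \<noteq> []" using \<pi> N by auto
  have n: "length \<pi> = card N" using distinct_card[OF \<pi>(1)] \<pi>(2) by simp
  show "real (queries f (threshold_cardinality k \<epsilon> \<pi>))
      \<le> 16 * (real (card N) / \<epsilon> * ln (real k))"
    using queries_threshold_cardinality_bound[OF eps k \<open>\<pi> \<noteq> []\<close>, of f] unfolding n .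
  fix S
  assume S: "S \<in> run f (threshold_cardinality k \<epsilon> \<pi>)"
  then have "S \<in> set ?C"
    unfolding run_threshold_cardinality by (elim CollectE conjE)
  then obtain \<theta> where G: "S = run f (threshold_greedy k \<theta> \<pi> {})"
    unfolding candidate_sets_def set_map by (rule imageE)
  show "S \<subseteq> N" using threshold_greedy_subset[of f k \<theta> \<pi> "{}"] unfolding G \<pi>(2) by simp
  show "card S \<le> k" unfolding G by (rule threshold_greedy_card) simp
  let ?V = "{f T |T. T \<subseteq> N \<and> card T \<le> k}"
  have "finite ?V"
    by (rule finite_subset[of _ "f ` Pow N"]) (use N in auto)
  moreover have "f {} \<in> ?V"
    by (intro CollectI exI[of _ "{}"]) simp
  ultimately have "Max ?V \<in> ?V" by (intro Max_in) auto
  then obtain T where T: "T \<subseteq> N" "card T \<le> k" "Max ?V = f T" by auto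
  have "(1 - \<epsilon>) * (f T / 2) \<le> f S"
    using threshold_cardinality_approximation[OF order perm mono sub empty eps k N S T(1,2)] .
  then show "(1 - \<epsilon>) * 0.5 * Max ?V \<le> f S"
    unfolding T(3) by simp
qed

end
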